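(* Let $n,k\ge 1$ be integers, let $A^{(1)},\dots,A^{(k)}\in M_n(\mathbb{C})$ be zero diagonal Hermitian contractions, and let $0<\epsilon<1$. Then there is a subset $\sigma\subset[n]$ of size $\left\lfloor \dfrac{n\epsilon^2}{6k}\right\rfloor$ such that $$\lambda_{\max}\left(P_\sigma A^{(j)}P_\sigma\right)<\epsilon\qquad\text{for all } j\in[k].$$
   Context: $[n]=\{1,\dots,n\}$. A zero diagonal matrix is one all of whose diagonal entries are $0$; a contraction is a matrix of operator norm at most $1$. For $\sigma\subseteq[n]$, $P_\sigma\in M_n(\mathbb{C})$ is the diagonal projection onto the coordinates in $\sigma$. $\lambda_{\max}(M)$ is the largest eigenvalue of the Hermitian matrix $M$. *)

theory Defs
  imports
    "Jordan_Normal_Form.Schur_Decomposition"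
    "Jordan_Normal_Form.Spectral_Radius"
begin

definition hermitian_mat :: "complex mat \<Rightarrow> bool" where
  "hermitian_mat A \<longleftrightarrow> mat_adjoint A = A"

definition zero_diagonal :: "complex mat \<Rightarrow> bool" where
  "zero_diagonal A \<longleftrightarrow> (\<forall>i < dim_row A. A $$ (i, i) = 0)"

definition l2_norm :: "complex vec \<Rightarrow> real" where
  "l2_norm v = sqrt (\<Sum>i < dim_vec v. (cmod (v $ i))\<^sup>2)"

(* A real supremum: meaningful when A has at least one column, so that unit vectors exist. *)
definition op_norm :: "complex mat \<Rightarrow> real" where
  "op_norm A = (SUP v \<in> {v \<in> carrier_vec (dim_col A). l2_norm v = 1}. l2_norm (A *\<^sub>v v))"

definition contraction_mat :: "complex mat \<Rightarrow> bool" where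
  "contraction_mat A \<longleftrightarrow> op_norm A \<le> 1"

(* Coordinates are indexed from 0, so the coordinate set [n] is {..<n}. *)
definition diag_proj :: "nat \<Rightarrow> nat set \<Rightarrow> complex mat" where
  "diag_proj n \<sigma> = mat_diag n (\<lambda>i. if i \<in> \<sigma> then 1 else 0)"

(* Intended for Hermitian matrices of positive dimension, whose spectrum is real,
   finite and nonempty. *)
definition lambda_max :: "complex mat \<Rightarrow> real" where
  "lambda_max M = Max {x :: real. eigenvalue M (complex_of_real x)}"

end

theory Submission
  imports Defs
begin

text \<open>
  The set \<open>\<sigma>\<close> is built greedily, one coordinate at a time, with a moving barrier that controls all
  \<open>k\<close> matrices at once. While \<open>b - A\<^sub>\<sigma>\<close> stays positive definite for every matrix \<open>A\<close> of
  the collection, the potential is \<open>T = \<Sum>\<^sub>A tr (b - A\<^sub>\<sigma>)\<inverse>\<close>.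
  Suppose the barrier is first raised from \<open>b\<close> to \<open>b' = b + \<delta>\<close> and the coordinate \<open>i\<close> is then added.
  With \<open>B = (b' - A\<^sub>\<sigma>)\<inverse>\<close> and \<open>v\<close> the column of \<open>A\<close> that couples \<open>i\<close> to \<open>\<sigma>\<close>,
  the new Schur complement is \<open>b' - v\<^sup>* B v\<close>, because the diagonal of \<open>A\<close> is zero, and the trace of the
  inverse grows by \<open>(1 + \<parallel>B v\<parallel>\<^sup>2) / (b' - v\<^sup>* B v)\<close> (\<open>psd_inverse_insert\<close>).

  Since \<open>A\<close> is a contraction, summing over \<open>i \<notin> \<sigma>\<close> gives \<open>\<Sum> v\<^sup>* B v \<le> tr B\<close> and
  \<open>\<Sum> \<parallel>B v\<parallel>\<^sup>2 \<le> tr B\<^sup>2\<close> (\<open>sum_coupling_le\<close>, \<open>sum_border_corr_le\<close>), while raising the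
  barrier lowers \<open>tr B\<close> by at least \<open>\<delta> tr B\<^sup>2\<close> (\<open>trace_drop_under_shift\<close>). Let \<open>x\<^sub>i\<close> and \<open>y\<^sub>i\<close>
  be the sums over the \<open>k\<close> matrices of \<open>\<parallel>B v\<parallel>\<^sup>2\<close> and of \<open>v\<^sup>* B v\<close>. All these terms are nonnegative,
  so \<open>b' - y\<^sub>i\<close> is at most each of the \<open>k\<close> Schur complements, and the total growth is at most
  \<open>(k + x\<^sub>i) / (b' - y\<^sub>i)\<close>. It is thus enough to make this single ratio small, which averaging over
  \<open>i\<close> does.

  Let \<open>N = n - M\<close> bound the number of free coordinates from below, where \<open>M\<close> is the target size. If
  \<open>b' - T/N \<ge> c\<close> throughout and \<open>\<delta> = 1/(cN)\<close>, the drop caused by the shift pays for the \<open>x\<^sub>i\<close>,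
  and every step raises \<open>T\<close> by at most \<open>k/c\<close> (\<open>greedy_step\<close>). Starting the barrier at
  \<open>\<epsilon> - M\<delta>\<close>, so that it ends at \<open>\<epsilon>\<close>, the condition persists for \<open>c = \<epsilon>/2\<close> as soon as
  \<open>4kM \<le> \<epsilon>\<^sup>2 (n - M)\<close> (\<open>one_sided_paving\<close>). If \<open>M \<le> n\<epsilon>\<^sup>2/(6k)\<close> and
  \<open>\<epsilon> < 1\<close>, this follows from \<open>4kM + \<epsilon>\<^sup>2M \<le> 5kM \<le> \<epsilon>\<^sup>2n\<close>.

  Principal submatrices are treated as functions restricted to finite index sets, so that \<open>\<sigma>\<close> can
  grow without any change of dimension. Positivity of an inverse is recorded by a Gram factorisation, which
  bordering produces together with the inverse itself.
\<close>

section \<open>Hermitian matrices on finite index sets\<close>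

definition mv :: "'a set \<Rightarrow> ('a \<Rightarrow> 'a \<Rightarrow> complex) \<Rightarrow> ('a \<Rightarrow> complex) \<Rightarrow> 'a \<Rightarrow> complex" where
  "mv \<sigma> M x = (\<lambda>l. \<Sum>m\<in>\<sigma>. M l m * x m)"

definition ip :: "'a set \<Rightarrow> ('a \<Rightarrow> complex) \<Rightarrow> ('a \<Rightarrow> complex) \<Rightarrow> complex" where
  "ip \<sigma> x y = (\<Sum>l\<in>\<sigma>. cnj (x l) * y l)"

definition sqnorm :: "'a set \<Rightarrow> ('a \<Rightarrow> complex) \<Rightarrow> real" where
  "sqnorm \<sigma> x = (\<Sum>l\<in>\<sigma>. (cmod (x l))\<^sup>2)"

definition hermitian_on :: "'a set \<Rightarrow> ('a \<Rightarrow> 'a \<Rightarrow> complex) \<Rightarrow> bool" where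
  "hermitian_on \<sigma> M \<longleftrightarrow> (\<forall>l\<in>\<sigma>. \<forall>m\<in>\<sigma>. M m l = cnj (M l m))"

lemma hermitian_onD: "hermitian_on \<sigma> M \<Longrightarrow> l \<in> \<sigma> \<Longrightarrow> m \<in> \<sigma> \<Longrightarrow> cnj (M l m) = M m l"
  unfolding hermitian_on_def by (metis (no_types))

lemma hermitian_on_subset: "hermitian_on \<tau> M \<Longrightarrow> \<sigma> \<subseteq> \<tau> \<Longrightarrow> hermitian_on \<sigma> M"
  unfolding hermitian_on_def by (meson subsetD)

definition posdef_on :: "'a set \<Rightarrow> ('a \<Rightarrow> 'a \<Rightarrow> complex) \<Rightarrow> bool" where
  "posdef_on \<sigma> M \<longleftrightarrow> (\<forall>x. (\<exists>l\<in>\<sigma>. x l \<noteq> 0) \<longrightarrow> 0 < Re (ip \<sigma> x (mv \<sigma> M x)))"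

definition is_gram :: "'a set \<Rightarrow> ('a \<Rightarrow> 'a \<Rightarrow> complex) \<Rightarrow> ('a \<Rightarrow> 'a \<Rightarrow> complex) \<Rightarrow> bool" where
  "is_gram \<sigma> B C \<longleftrightarrow> (\<forall>l\<in>\<sigma>. \<forall>m\<in>\<sigma>. B l m = (\<Sum>r\<in>\<sigma>. C l r * cnj (C m r)))"

lemma is_gramD:
  "is_gram \<sigma> B C \<Longrightarrow> l \<in> \<sigma> \<Longrightarrow> m \<in> \<sigma> \<Longrightarrow> B l m = (\<Sum>r\<in>\<sigma>. C l r * cnj (C m r))"
  by (simp add: is_gram_def)

text \<open>Both \<open>M\<close> and \<open>B\<close> may have arbitrary entries outside \<open>\<sigma> \<times> \<sigma>\<close>. The Gram factor \<open>C\<close>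
  certifies that \<open>B\<close> is Hermitian and positive semidefinite, and its columns are what a contraction
  is applied to when traces are estimated.\<close>

definition psd_inverse :: "'a set \<Rightarrow> ('a \<Rightarrow> 'a \<Rightarrow> complex) \<Rightarrow> ('a \<Rightarrow> 'a \<Rightarrow> complex) \<Rightarrow> bool" where
  "psd_inverse \<sigma> M B \<longleftrightarrow>
     (\<forall>l\<in>\<sigma>. \<forall>m\<in>\<sigma>. (\<Sum>p\<in>\<sigma>. M l p * B p m) = (if l = m then 1 else 0)) \<and>
     (\<exists>C. is_gram \<sigma> B C)"

definition tr_on :: "'a set \<Rightarrow> ('a \<Rightarrow> 'a \<Rightarrow> complex) \<Rightarrow> real" where
  "tr_on \<sigma> B = (\<Sum>l\<in>\<sigma>. Re (B l l))"

lemma ip_self: "ip \<sigma> x x = of_real (sqnorm \<sigma> x)"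
  unfolding ip_def sqnorm_def of_real_sum
  by (intro sum.cong refl) (metis complex_norm_square mult.commute)

lemma Re_mult_cnj: "Re (z * cnj z) = (cmod z)\<^sup>2"
  unfolding complex_norm_square[symmetric] by simp

lemma sqnorm_nonneg: "0 \<le> sqnorm \<sigma> x"
  unfolding sqnorm_def by (simp add: sum_nonneg)

lemma sqnorm_cong: "(\<And>l. l \<in> \<sigma> \<Longrightarrow> x l = y l) \<Longrightarrow> sqnorm \<sigma> x = sqnorm \<sigma> y"
  unfolding sqnorm_def by (intro sum.cong) auto

lemma ip_cong:
  "(\<And>l. l \<in> \<sigma> \<Longrightarrow> x l = x' l) \<Longrightarrow> (\<And>l. l \<in> \<sigma> \<Longrightarrow> y l = y' l) \<Longrightarrow> ip \<sigma> x y = ip \<sigma> x' y'"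
  unfolding ip_def by (intro sum.cong) auto

lemma mv_cong: "(\<And>l. l \<in> \<sigma> \<Longrightarrow> x l = x' l) \<Longrightarrow> mv \<sigma> M x = mv \<sigma> M x'"
  unfolding mv_def by (intro ext sum.cong) auto

lemma mv_add_scaled: "mv \<sigma> M (\<lambda>l. x l + c * y l) i = mv \<sigma> M x i + c * mv \<sigma> M y i"
  by (simp add: mv_def distrib_left sum.distrib sum_distrib_left mult.left_commute)

lemma ip_add_scaled_left:
  "ip \<sigma> (\<lambda>l. x l + of_real c * y l) z = ip \<sigma> x z + of_real c * ip \<sigma> y z"
  by (simp add: ip_def distrib_right sum.distrib sum_distrib_left mult.assoc)

lemma ip_mv_hermitian:
  assumes "hermitian_on \<sigma> M"
  shows "ip \<sigma> x (mv \<sigma> M y) = ip \<sigma> (mv \<sigma> M x) y"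
proof -
  have "ip \<sigma> x (mv \<sigma> M y) = (\<Sum>l\<in>\<sigma>. \<Sum>m\<in>\<sigma>. cnj (x l) * (M l m * y m))"
    by (simp add: ip_def mv_def sum_distrib_left)
  also have "\<dots> = (\<Sum>m\<in>\<sigma>. \<Sum>l\<in>\<sigma>. cnj (x l) * (M l m * y m))"
    by (rule sum.swap)
  also have "\<dots> = ip \<sigma> (mv \<sigma> M x) y"
    unfolding ip_def mv_def cnj_sum sum_distrib_right
    by (intro sum.cong refl) (simp add: hermitian_onD[OF assms] mult_ac)
  finally show ?thesis .
qed

lemma mv_mv_cancel:
  assumes "finite \<sigma>" "l \<in> \<sigma>"
    and "\<And>m. m \<in> \<sigma> \<Longrightarrow> (\<Sum>p\<in>\<sigma>. X l p * Y p m) = (if l = m then 1 else 0)"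
  shows "mv \<sigma> X (mv \<sigma> Y x) l = x l"
proof -
  have "mv \<sigma> X (mv \<sigma> Y x) l = (\<Sum>p\<in>\<sigma>. \<Sum>m\<in>\<sigma>. X l p * (Y p m * x m))"
    by (simp add: mv_def sum_distrib_left)
  also have "\<dots> = (\<Sum>m\<in>\<sigma>. (\<Sum>p\<in>\<sigma>. X l p * Y p m) * x m)"
    by (subst sum.swap) (simp add: sum_distrib_left sum_distrib_right mult_ac)
  also have "\<dots> = (\<Sum>m\<in>\<sigma>. if l = m then x m else 0)"
    using assms(3) by (intro sum.cong) auto
  also have "\<dots> = x l" using assms(1,2) by simp
  finally show ?thesis .
qed

lemma psd_inverse_eq:
  assumes "psd_inverse \<sigma> M B" "l \<in> \<sigma>" "m \<in> \<sigma>"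
  shows "(\<Sum>p\<in>\<sigma>. M l p * B p m) = (if l = m then 1 else 0)"
  using assms unfolding psd_inverse_def by blast

lemma psd_inverse_gram:
  assumes "psd_inverse \<sigma> M B"
  obtains C where "is_gram \<sigma> B C"
  using assms unfolding psd_inverse_def by blast

lemma psd_inverse_hermitian:
  assumes "psd_inverse \<sigma> M B" shows "hermitian_on \<sigma> B"
proof -
  obtain C where gram: "is_gram \<sigma> B C"
    by (rule psd_inverse_gram[OF assms])
  note C = is_gramD[OF gram]
  show ?thesis
    unfolding hermitian_on_def
  proof (intro ballI)
    fix l m assume lm: "l \<in> \<sigma>" "m \<in> \<sigma>"
    have "B m l = (\<Sum>r\<in>\<sigma>. cnj (C l r * cnj (C m r)))"
      using C[OF lm(2,1)] by (simp add: mult.commute)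
    then show "B m l = cnj (B l m)" by (simp only: C[OF lm] cnj_sum)
  qed
qed

lemma psd_inverse_right:
  assumes "finite \<sigma>" "psd_inverse \<sigma> M B" "l \<in> \<sigma>"
  shows "mv \<sigma> M (mv \<sigma> B x) l = x l"
proof (rule mv_mv_cancel[of \<sigma> l M B x])
  fix m assume "m \<in> \<sigma>"
  then show "(\<Sum>p\<in>\<sigma>. M l p * B p m) = (if l = m then 1 else 0)"
    using psd_inverse_eq[of \<sigma> M B l m] assms(2,3) by simp
qed (use assms in simp_all)

text \<open>For Hermitian \<open>M\<close> and \<open>B\<close>, taking adjoints turns \<open>M B = 1\<close> into \<open>B M = 1\<close>.\<close>

lemma psd_inverse_left:
  assumes "finite \<sigma>" "psd_inverse \<sigma> M B" "hermitian_on \<sigma> M" "l \<in> \<sigma>"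
  shows "mv \<sigma> B (mv \<sigma> M x) l = x l"
proof (rule mv_mv_cancel[of \<sigma> l B M x])
  fix m assume m: "m \<in> \<sigma>"
  have "(\<Sum>p\<in>\<sigma>. B l p * M p m) = cnj (\<Sum>p\<in>\<sigma>. M m p * B p l)"
    unfolding cnj_sum
    using assms(4) m
    by (intro sum.cong refl)
      (simp add: hermitian_onD[OF assms(3)] hermitian_onD[OF psd_inverse_hermitian[OF assms(2)]] mult.commute)
  also have "(\<Sum>p\<in>\<sigma>. M m p * B p l) = (if m = l then 1 else 0)"
    using psd_inverse_eq[OF assms(2) m assms(4)] .
  finally show "(\<Sum>p\<in>\<sigma>. B l p * M p m) = (if l = m then 1 else 0)" by auto
qed (use assms in simp_all)

lemma gram_quadratic_form:
  assumes "is_gram \<sigma> B C"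
  shows "ip \<sigma> x (mv \<sigma> B x) = of_real (sqnorm \<sigma> (\<lambda>r. \<Sum>l\<in>\<sigma>. cnj (C l r) * x l))"
proof -
  have "ip \<sigma> x (mv \<sigma> B x) = (\<Sum>l\<in>\<sigma>. \<Sum>m\<in>\<sigma>. \<Sum>r\<in>\<sigma>. cnj (x l) * C l r * (cnj (C m r) * x m))"
    unfolding ip_def mv_def sum_distrib_left
    by (intro sum.cong refl)
      (simp only: is_gramD[OF assms] sum_distrib_right[where A = \<sigma>] sum_distrib_left[where A = \<sigma>] mult.assoc)
  also have "\<dots> = (\<Sum>l\<in>\<sigma>. \<Sum>r\<in>\<sigma>. \<Sum>m\<in>\<sigma>. cnj (x l) * C l r * (cnj (C m r) * x m))"
    by (rule sum.cong[OF refl]) (rule sum.swap)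
  also have "\<dots> = (\<Sum>r\<in>\<sigma>. \<Sum>l\<in>\<sigma>. \<Sum>m\<in>\<sigma>. cnj (x l) * C l r * (cnj (C m r) * x m))"
    by (rule sum.swap)
  also have "\<dots> = ip \<sigma> (\<lambda>r. \<Sum>l\<in>\<sigma>. cnj (C l r) * x l) (\<lambda>r. \<Sum>l\<in>\<sigma>. cnj (C l r) * x l)"
    unfolding ip_def
  proof (intro sum.cong refl)
    fix r
    have "cnj (\<Sum>l\<in>\<sigma>. cnj (C l r) * x l) = (\<Sum>l\<in>\<sigma>. cnj (x l) * C l r)"
      by (simp add: mult.commute)
    then show "(\<Sum>l\<in>\<sigma>. \<Sum>m\<in>\<sigma>. cnj (x l) * C l r * (cnj (C m r) * x m)) =
        cnj (\<Sum>l\<in>\<sigma>. cnj (C l r) * x l) * (\<Sum>l\<in>\<sigma>. cnj (C l r) * x l)"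
      by (simp only: sum_product)
  qed
  finally show ?thesis by (simp add: ip_self)
qed

text \<open>Writing \<open>z = M x\<close> and \<open>x = B z\<close> gives \<open>x\<^sup>* M x = z\<^sup>* B z = \<parallel>C\<^sup>* z\<parallel>\<^sup>2\<close>, and if this
  vanishes then so does \<open>x = C (C\<^sup>* z)\<close>.\<close>

lemma psd_inverse_posdef:
  assumes fin: "finite \<sigma>" and inv: "psd_inverse \<sigma> M B" and herm: "hermitian_on \<sigma> M"
  shows "posdef_on \<sigma> M"
  unfolding posdef_on_def
proof (intro allI impI)
  fix x :: "'a \<Rightarrow> complex"
  assume nz: "\<exists>l\<in>\<sigma>. x l \<noteq> 0"
  obtain C where gram: "is_gram \<sigma> B C"
    by (rule psd_inverse_gram[OF inv])
  note C = is_gramD[OF gram]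
  define z where "z = mv \<sigma> M x"
  define h where "h = (\<lambda>r. \<Sum>l\<in>\<sigma>. cnj (C l r) * z l)"
  have "ip \<sigma> x (mv \<sigma> M x) = ip \<sigma> (mv \<sigma> B z) z"
    using psd_inverse_left[OF fin inv herm] by (intro ip_cong) (auto simp: z_def)
  also have "\<dots> = ip \<sigma> z (mv \<sigma> B z)"
    using ip_mv_hermitian[OF psd_inverse_hermitian[OF inv]] by metis
  also have "\<dots> = of_real (sqnorm \<sigma> h)"
    unfolding h_def by (rule gram_quadratic_form[OF gram])
  finally have eq: "ip \<sigma> x (mv \<sigma> M x) = of_real (sqnorm \<sigma> h)" .
  have "sqnorm \<sigma> h \<noteq> 0"
  proof
    assume "sqnorm \<sigma> h = 0"
    then have h0: "\<And>r. r \<in> \<sigma> \<Longrightarrow> h r = 0"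
      using fin by (auto simp: sqnorm_def sum_nonneg_eq_0_iff)
    have "x l = 0" if l: "l \<in> \<sigma>" for l
    proof -
      have "x l = mv \<sigma> B z l" using psd_inverse_left[OF fin inv herm l] by (simp add: z_def)
      also have "\<dots> = (\<Sum>m\<in>\<sigma>. \<Sum>r\<in>\<sigma>. C l r * (cnj (C m r) * z m))"
        by (simp add: mv_def C l sum_distrib_right mult.assoc)
      also have "\<dots> = (\<Sum>r\<in>\<sigma>. C l r * h r)"
        by (subst sum.swap) (simp add: h_def sum_distrib_left)
      finally show ?thesis using h0 by simp
    qed
    with nz show False by auto
  qed
  with sqnorm_nonneg[of \<sigma> h] show "0 < Re (ip \<sigma> x (mv \<sigma> M x))" by (simp add: eq)
qed

section \<open>Bordering by one coordinate\<close>

text \<open>The solution \<open>u\<close> of \<open>M\<^sub>\<sigma> u = v\<close>, where \<open>v\<close> is the part of column \<open>i\<close> of \<open>M\<close> in the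
  rows \<open>\<sigma>\<close>: subtracting it from the unit vector \<open>e\<^sub>i\<close> eliminates the border.\<close>

definition border_corr :: "'a set \<Rightarrow> ('a \<Rightarrow> 'a \<Rightarrow> complex) \<Rightarrow> ('a \<Rightarrow> 'a \<Rightarrow> complex) \<Rightarrow> 'a \<Rightarrow> 'a \<Rightarrow> complex" where
  "border_corr \<sigma> M B i = mv \<sigma> B (\<lambda>l. M l i)"

definition schur_compl :: "'a set \<Rightarrow> ('a \<Rightarrow> 'a \<Rightarrow> complex) \<Rightarrow> ('a \<Rightarrow> 'a \<Rightarrow> complex) \<Rightarrow> 'a \<Rightarrow> real" where
  "schur_compl \<sigma> M B i = Re (M i i) - Re (ip \<sigma> (\<lambda>l. M l i) (border_corr \<sigma> M B i))"

text \<open>The vector \<open>e\<^sub>i - u\<close> is mapped to a multiple of \<open>e\<^sub>i\<close>; the factor is the Schur complement,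
  which the Gram form of \<open>B\<close> shows to be real.\<close>

lemma bordering_vector:
  assumes fin: "finite \<sigma>" and i: "i \<notin> \<sigma>" and herm: "hermitian_on (insert i \<sigma>) M"
    and inv: "psd_inverse \<sigma> M B"
    and w: "w = (\<lambda>l. if l = i then 1 else - border_corr \<sigma> M B i l)"
    and l: "l \<in> insert i \<sigma>"
  shows "mv (insert i \<sigma>) M w l = (if l = i then of_real (schur_compl \<sigma> M B i) else 0)"
proof -
  define u where "u = border_corr \<sigma> M B i"
  have "mv (insert i \<sigma>) M w l = M l i + (\<Sum>m\<in>\<sigma>. M l m * - u m)"
    unfolding mv_def using fin i by (auto simp: w u_def intro!: sum.cong)
  then have split: "mv (insert i \<sigma>) M w l = M l i - mv \<sigma> M u l"
    by (simp add: mv_def sum_negf)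
  show ?thesis
  proof (cases "l = i")
    case False
    then have "l \<in> \<sigma>" using l by auto
    then have "mv \<sigma> M u l = M l i"
      unfolding u_def border_corr_def using psd_inverse_right[OF fin inv] by simp
    then show ?thesis using False split by simp
  next
    case True
    obtain C where gram: "is_gram \<sigma> B C"
      by (rule psd_inverse_gram[OF inv])
    have "mv \<sigma> M u i = ip \<sigma> (\<lambda>l. M l i) u"
      unfolding mv_def ip_def by (intro sum.cong refl) (simp add: hermitian_onD[OF herm])
    moreover have "Im (ip \<sigma> (\<lambda>l. M l i) u) = 0"
      unfolding u_def border_corr_def by (simp add: gram_quadratic_form[OF gram])
    moreover have "Im (M i i) = 0"
      using hermitian_onD[OF herm, of i i] by (simp add: complex_eq_iff)
    ultimately show ?thesis using True split
      by (simp add: schur_compl_def u_def complex_eq_iff)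
  qed
qed

text \<open>Block inversion as a rank-one update: with \<open>w = e\<^sub>i - u\<close> and \<open>s\<close> the Schur complement, the
  new inverse is \<open>B + w w\<^sup>* / s\<close>. Since \<open>s\<close> is positive, the update adds the column
  \<open>w / sqrt s\<close> to the Gram factor, and it adds \<open>\<parallel>w\<parallel>\<^sup>2 / s = (1 + \<parallel>u\<parallel>\<^sup>2) / s\<close> to the trace.\<close>

lemma psd_inverse_insert:
  fixes M B :: "'a \<Rightarrow> 'a \<Rightarrow> complex"
  assumes fin: "finite \<sigma>" and i: "i \<notin> \<sigma>" and herm: "hermitian_on (insert i \<sigma>) M"
    and inv: "psd_inverse \<sigma> M B"
    and s: "0 < schur_compl \<sigma> M B i"
  shows "\<exists>B'. psd_inverse (insert i \<sigma>) M B' \<and>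
     tr_on (insert i \<sigma>) B' =
       tr_on \<sigma> B + (1 + sqnorm \<sigma> (border_corr \<sigma> M B i)) / schur_compl \<sigma> M B i"
proof -
  define u where "u = border_corr \<sigma> M B i"
  define s where "s = schur_compl \<sigma> M B i"
  define w where "w = (\<lambda>l. if l = i then 1 else - u l)"
  define B' where "B' = (\<lambda>l m. (if l \<in> \<sigma> \<and> m \<in> \<sigma> then B l m else 0) + w l * cnj (w m) / of_real s)"
  have s0: "0 < s" using s by (simp add: s_def)
  have Mw: "mv (insert i \<sigma>) M w l = (if l = i then of_real s else 0)" if "l \<in> insert i \<sigma>" for l
    unfolding s_def by (rule bordering_vector[OF fin i herm inv _ that]) (unfold w_def u_def, rule refl)
  obtain C where gram: "is_gram \<sigma> B C"
    by (rule psd_inverse_gram[OF inv])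
  note C = is_gramD[OF gram]
  define C' where "C' = (\<lambda>l r. if r = i then w l / of_real (sqrt s) else if l \<in> \<sigma> then C l r else 0)"
  have gram': "B' l m = (\<Sum>r\<in>insert i \<sigma>. C' l r * cnj (C' m r))" for l m
  proof -
    have "(\<Sum>r\<in>insert i \<sigma>. C' l r * cnj (C' m r)) = C' l i * cnj (C' m i) + (\<Sum>r\<in>\<sigma>. C' l r * cnj (C' m r))"
      using fin i by simp
    also have "C' l i * cnj (C' m i) = w l * cnj (w m) / of_real s"
      using s0 by (simp add: C'_def flip: of_real_mult)
    also have "(\<Sum>r\<in>\<sigma>. C' l r * cnj (C' m r)) = (if l \<in> \<sigma> \<and> m \<in> \<sigma> then B l m else 0)"
    proof (cases "l \<in> \<sigma> \<and> m \<in> \<sigma>")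
      case True
      then show ?thesis using i C[of l m] by (auto simp: C'_def intro!: sum.cong)
    next
      case False
      have "(\<Sum>r\<in>\<sigma>. C' l r * cnj (C' m r)) = 0"
        by (rule sum.neutral) (use False i in \<open>auto simp: C'_def\<close>)
      then show ?thesis using False by auto
    qed
    finally show ?thesis by (simp add: B'_def)
  qed
  have eqn: "(\<Sum>p\<in>insert i \<sigma>. M l p * B' p m) = (if l = m then 1 else 0)"
    if l: "l \<in> insert i \<sigma>" and m: "m \<in> insert i \<sigma>" for l m
  proof -
    have "(\<Sum>p\<in>insert i \<sigma>. M l p * B' p m) =
        (\<Sum>p\<in>insert i \<sigma>. M l p * (if p \<in> \<sigma> \<and> m \<in> \<sigma> then B p m else 0))
        + (\<Sum>p\<in>insert i \<sigma>. M l p * w p * (cnj (w m) / of_real s))"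
      by (simp add: B'_def distrib_left sum.distrib mult_ac)
    also have "(\<Sum>p\<in>insert i \<sigma>. M l p * w p * (cnj (w m) / of_real s)) =
        mv (insert i \<sigma>) M w l * (cnj (w m) / of_real s)"
      unfolding mv_def by (rule sum_distrib_right[symmetric])
    also have "\<dots> = (if l = i then cnj (w m) else 0)"
      using Mw[OF l] s0 by simp
    also have "(\<Sum>p\<in>insert i \<sigma>. M l p * (if p \<in> \<sigma> \<and> m \<in> \<sigma> then B p m else 0)) =
        (if m \<in> \<sigma> then (\<Sum>p\<in>\<sigma>. M l p * B p m) else 0)"
      using fin i by auto
    finally have eq: "(\<Sum>p\<in>insert i \<sigma>. M l p * B' p m) =
        (if m \<in> \<sigma> then (\<Sum>p\<in>\<sigma>. M l p * B p m) else 0) + (if l = i then cnj (w m) else 0)" .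
    show ?thesis
    proof (cases "m \<in> \<sigma>")
      case False
      then have "m = i" using m by auto
      then show ?thesis using eq False by (auto simp: w_def)
    next
      case True
      then have mi: "m \<noteq> i" using i by auto
      show ?thesis
      proof (cases "l = i")
        case False
        then have "l \<in> \<sigma>" using l by auto
        then show ?thesis using eq True False psd_inverse_eq[OF inv] by simp
      next
        case li: True
        have "(\<Sum>p\<in>\<sigma>. M i p * B p m) = cnj (u m)"
          unfolding u_def border_corr_def mv_def cnj_sum
          using True
          by (intro sum.cong refl)
            (simp add: hermitian_onD[OF herm] hermitian_onD[OF psd_inverse_hermitian[OF inv]])
        then show ?thesis using eq True li mi by (simp add: w_def)
      qed
    qed
  qed
  have tr: "tr_on (insert i \<sigma>) B' = tr_on \<sigma> B + (1 + sqnorm \<sigma> u) / s"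
  proof -
    have "tr_on (insert i \<sigma>) B' = Re (B' i i) + (\<Sum>l\<in>\<sigma>. Re (B' l l))"
      using fin i by (simp add: tr_on_def)
    also have "Re (B' i i) = 1 / s" using i by (simp add: B'_def w_def flip: of_real_divide)
    also have "(\<Sum>l\<in>\<sigma>. Re (B' l l)) = (\<Sum>l\<in>\<sigma>. Re (B l l) + (cmod (u l))\<^sup>2 / s)"
    proof (intro sum.cong refl)
      fix l assume l: "l \<in> \<sigma>"
      have "w l * cnj (w l) / of_real s = of_real ((cmod (u l))\<^sup>2 / s)"
        using l i complex_norm_square[of "u l"] by (auto simp: w_def)
      then have "B' l l = B l l + of_real ((cmod (u l))\<^sup>2 / s)"
        using l by (simp only: B'_def) simp
      then show "Re (B' l l) = Re (B l l) + (cmod (u l))\<^sup>2 / s" by simp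
    qed
    finally show ?thesis
      by (simp add: tr_on_def sqnorm_def sum.distrib sum_divide_distrib add_divide_distrib)
  qed
  have "is_gram (insert i \<sigma>) B' C'"
    unfolding is_gram_def using gram' by blast
  then have "psd_inverse (insert i \<sigma>) M B'"
    unfolding psd_inverse_def using eqn by blast
  with tr show ?thesis unfolding u_def s_def by blast
qed

lemma posdef_subset:
  assumes "finite \<tau>" "\<sigma> \<subseteq> \<tau>" "posdef_on \<tau> M"
  shows "posdef_on \<sigma> M"
  unfolding posdef_on_def
proof (intro allI impI)
  fix x :: "'a \<Rightarrow> complex"
  assume nz: "\<exists>l\<in>\<sigma>. x l \<noteq> 0"
  define y where "y = (\<lambda>l. if l \<in> \<sigma> then x l else 0)"
  have mv: "mv \<tau> M y = mv \<sigma> M x"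
    unfolding mv_def using assms(1,2)
    by (intro ext sum.mono_neutral_cong_right) (auto simp: y_def)
  have "ip \<tau> y (mv \<tau> M y) = ip \<sigma> x (mv \<sigma> M x)"
    unfolding mv unfolding ip_def using assms(1,2)
    by (intro sum.mono_neutral_cong_right) (auto simp: y_def)
  moreover have "\<exists>l\<in>\<tau>. y l \<noteq> 0" using nz assms(2) by (auto simp: y_def)
  ultimately show "0 < Re (ip \<sigma> x (mv \<sigma> M x))"
    using assms(3) unfolding posdef_on_def by metis
qed

text \<open>The Schur complement is the value of the quadratic form of \<open>M\<close> at the nonzero vector
  \<open>e\<^sub>i - u\<close>.\<close>

lemma posdef_schur_pos:
  assumes fin: "finite \<sigma>" and i: "i \<notin> \<sigma>" and herm: "hermitian_on (insert i \<sigma>) M"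
    and inv: "psd_inverse \<sigma> M B" and pd: "posdef_on (insert i \<sigma>) M"
  shows "0 < schur_compl \<sigma> M B i"
proof -
  define w where "w = (\<lambda>l. if l = i then 1 else - border_corr \<sigma> M B i l)"
  have "ip (insert i \<sigma>) w (mv (insert i \<sigma>) M w) =
      ip (insert i \<sigma>) w (\<lambda>l. if l = i then of_real (schur_compl \<sigma> M B i) else 0)"
    by (rule ip_cong) (auto simp: bordering_vector[OF fin i herm inv w_def])
  also have "\<dots> = of_real (schur_compl \<sigma> M B i)"
    using fin i by (simp add: ip_def w_def if_distrib cong: if_cong)
  finally show ?thesis
    using pd by (auto simp: posdef_on_def w_def dest!: spec[of _ w])
qed

text \<open>Bordering one coordinate after another constructs the inverse and its Gram factor at the same time;
  this is Cholesky factorisation of the inverse.\<close>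

lemma posdef_psd_inverse:
  assumes "finite \<sigma>" "hermitian_on \<sigma> M" "posdef_on \<sigma> M"
  shows "\<exists>B. psd_inverse \<sigma> M B"
  using assms
proof (induction \<sigma> rule: finite_induct)
  case empty
  then show ?case by (auto simp: psd_inverse_def is_gram_def)
next
  case (insert i \<sigma>)
  have "posdef_on \<sigma> M" using posdef_subset[of "insert i \<sigma>" \<sigma> M] insert by auto
  moreover have "hermitian_on \<sigma> M" using insert.prems(1) by (rule hermitian_on_subset) auto
  ultimately obtain B where B: "psd_inverse \<sigma> M B" using insert.IH by blast
  have "0 < schur_compl \<sigma> M B i"
    using posdef_schur_pos[OF insert.hyps(1,2) insert.prems(1) B insert.prems(2)] .
  with psd_inverse_insert[OF insert.hyps(1,2) insert.prems(1) B] show ?case by blast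
qed

section \<open>The barrier shift\<close>

definition shifted :: "real \<Rightarrow> ('a \<Rightarrow> 'a \<Rightarrow> complex) \<Rightarrow> 'a \<Rightarrow> 'a \<Rightarrow> complex" where
  "shifted b a = (\<lambda>l m. (if l = m then of_real b else 0) - a l m)"

lemma hermitian_on_shifted: "hermitian_on \<sigma> a \<Longrightarrow> hermitian_on \<sigma> (shifted b a)"
  unfolding hermitian_on_def[of _ "shifted b a"]
  by (intro ballI) (simp add: shifted_def hermitian_onD)

lemma mv_shifted:
  assumes "finite \<sigma>" "l \<in> \<sigma>"
  shows "mv \<sigma> (shifted b a) x l = of_real b * x l - mv \<sigma> a x l"
proof -
  have "mv \<sigma> (shifted b a) x l =
      (\<Sum>m\<in>\<sigma>. (if l = m then of_real b * x m else 0) - a l m * x m)"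
    unfolding mv_def shifted_def by (intro sum.cong) (auto simp: algebra_simps)
  then show ?thesis using assms by (simp add: sum_subtractf mv_def)
qed

lemma posdef_shifted_iff:
  assumes "finite \<sigma>"
  shows "posdef_on \<sigma> (shifted b a) \<longleftrightarrow>
    (\<forall>x. (\<exists>l\<in>\<sigma>. x l \<noteq> 0) \<longrightarrow> Re (ip \<sigma> x (mv \<sigma> a x)) < b * sqnorm \<sigma> x)"
proof -
  have "ip \<sigma> x (mv \<sigma> (shifted b a) x) = of_real (b * sqnorm \<sigma> x) - ip \<sigma> x (mv \<sigma> a x)" for x
  proof -
    have "ip \<sigma> x (mv \<sigma> (shifted b a) x) = ip \<sigma> x (\<lambda>l. of_real b * x l - mv \<sigma> a x l)"
      using assms by (intro ip_cong) (auto simp: mv_shifted)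
    also have "\<dots> = of_real b * ip \<sigma> x x - ip \<sigma> x (mv \<sigma> a x)"
      unfolding ip_def by (simp add: algebra_simps sum_subtractf sum_distrib_left)
    finally show ?thesis by (simp add: ip_self)
  qed
  then show ?thesis by (auto simp: posdef_on_def)
qed

lemma posdef_shifted_mono:
  assumes "finite \<sigma>" "b \<le> b'" "posdef_on \<sigma> (shifted b a)"
  shows "posdef_on \<sigma> (shifted b' a)"
  using assms mult_right_mono[OF assms(2) sqnorm_nonneg]
  by (fastforce simp: posdef_shifted_iff intro: less_le_trans)

text \<open>With \<open>d = b' - b\<close> the resolvent identity reads \<open>B - B' = d B B'\<close>, and
  \<open>tr (B B') = tr (B' B') + d tr (B' B B') \<ge> tr (B' B')\<close>. The double sum is \<open>tr (B' B')\<close>, the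
  squared Frobenius norm of \<open>B'\<close>. The inequality is proved for each diagonal entry separately, with
  \<open>g\<close> the column \<open>m\<close> of \<open>B'\<close>: then \<open>(b - a) g = e - d g\<close>, and hence
  \<open>e\<^sup>* B e - e\<^sup>* g = d (\<parallel>g\<parallel>\<^sup>2 + d g\<^sup>* B g)\<close>.\<close>

lemma trace_drop_under_shift:
  assumes fin: "finite \<sigma>" and herm: "hermitian_on \<sigma> a" and le: "b \<le> b'"
    and inv: "psd_inverse \<sigma> (shifted b a) B" and inv': "psd_inverse \<sigma> (shifted b' a) B'"
  shows "tr_on \<sigma> B' + (b' - b) * (\<Sum>m\<in>\<sigma>. sqnorm \<sigma> (\<lambda>l. B' l m)) \<le> tr_on \<sigma> B"
proof -
  define d where "d = b' - b"
  obtain C where gram: "is_gram \<sigma> B C"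
    by (rule psd_inverse_gram[OF inv])
  have "Re (B' m m) + d * sqnorm \<sigma> (\<lambda>l. B' l m) \<le> Re (B m m)" if m: "m \<in> \<sigma>" for m
  proof -
    define e :: "'a \<Rightarrow> complex" where "e = (\<lambda>l. if l = m then 1 else 0)"
    define g where "g = (\<lambda>l. B' l m)"
    define q where "q = sqnorm \<sigma> (\<lambda>r. \<Sum>l\<in>\<sigma>. cnj (C l r) * g l)"
    have ge: "g l = mv \<sigma> B' e l" for l
      unfolding mv_def g_def e_def using fin m by (simp add: if_distrib cong: if_cong)
    have Mg: "e l = mv \<sigma> (shifted b a) g l + of_real d * g l" if l: "l \<in> \<sigma>" for l
    proof -
      have "e l = mv \<sigma> (shifted b' a) g l"
        unfolding ge[abs_def] using psd_inverse_right[OF fin inv' l] by simp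
      then show ?thesis using fin l by (simp add: mv_shifted d_def algebra_simps)
    qed
    have hB: "hermitian_on \<sigma> B" using psd_inverse_hermitian[OF inv] .
    have BMg: "mv \<sigma> B (mv \<sigma> (shifted b a) g) l = g l" if "l \<in> \<sigma>" for l
      using psd_inverse_left[OF fin inv hermitian_on_shifted[OF herm] that] .
    have "mv \<sigma> B e m = mv \<sigma> B (\<lambda>l. mv \<sigma> (shifted b a) g l + of_real d * g l) m"
      by (intro fun_cong[OF mv_cong] Mg)
    also have "\<dots> = mv \<sigma> B (mv \<sigma> (shifted b a) g) m + of_real d * mv \<sigma> B g m"
      by (rule mv_add_scaled)
    also have "\<dots> = g m + of_real d * mv \<sigma> B g m" using BMg[OF m] by simp
    finally have 1: "mv \<sigma> B e m = g m + of_real d * mv \<sigma> B g m" .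
    have 2: "mv \<sigma> B e m = B m m"
      unfolding mv_def e_def using fin m by (simp add: if_distrib cong: if_cong)
    have "ip \<sigma> e (mv \<sigma> B g) = (\<Sum>l\<in>\<sigma>. if l = m then mv \<sigma> B g l else 0)"
      unfolding ip_def by (intro sum.cong) (auto simp: e_def)
    then have "mv \<sigma> B g m = ip \<sigma> e (mv \<sigma> B g)" using fin m by simp
    also have "\<dots> = ip \<sigma> (\<lambda>l. mv \<sigma> (shifted b a) g l + of_real d * g l) (mv \<sigma> B g)"
      using Mg by (intro ip_cong) auto
    also have "\<dots> = ip \<sigma> (mv \<sigma> (shifted b a) g) (mv \<sigma> B g) + of_real d * ip \<sigma> g (mv \<sigma> B g)"
      by (rule ip_add_scaled_left)
    also have "ip \<sigma> (mv \<sigma> (shifted b a) g) (mv \<sigma> B g) = ip \<sigma> g g"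
      unfolding ip_mv_hermitian[OF hB] using BMg by (intro ip_cong) auto
    also have "ip \<sigma> g (mv \<sigma> B g) = of_real q"
      unfolding q_def by (rule gram_quadratic_form[OF gram])
    finally have "mv \<sigma> B g m = of_real (sqnorm \<sigma> g + d * q)" by (simp add: ip_self)
    with 1 2 have "Re (B m m) = Re (g m) + d * (sqnorm \<sigma> g + d * q)" by simp
    moreover have "0 \<le> d * (d * q)"
      unfolding q_def using le by (intro mult_nonneg_nonneg sqnorm_nonneg) (auto simp: d_def)
    ultimately show ?thesis by (simp add: g_def algebra_simps)
  qed
  then have "(\<Sum>m\<in>\<sigma>. Re (B' m m) + d * sqnorm \<sigma> (\<lambda>l. B' l m)) \<le> (\<Sum>m\<in>\<sigma>. Re (B m m))"
    by (rule sum_mono)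
  then show ?thesis by (simp add: tr_on_def d_def sum.distrib sum_distrib_left)
qed

section \<open>Averages over the free coordinates\<close>

definition contraction_on :: "'a set \<Rightarrow> ('a \<Rightarrow> 'a \<Rightarrow> complex) \<Rightarrow> bool" where
  "contraction_on V a \<longleftrightarrow> (\<forall>x. sqnorm V (mv V a x) \<le> sqnorm V x)"

lemma contraction_compression:
  assumes "finite V" "\<sigma> \<subseteq> V" "contraction_on V a"
  shows "sqnorm (V - \<sigma>) (mv \<sigma> a x) \<le> sqnorm \<sigma> x"
proof -
  define y where "y = (\<lambda>l. if l \<in> \<sigma> then x l else 0)"
  have mv: "mv V a y = mv \<sigma> a x"
    unfolding mv_def using assms(1,2)
    by (intro ext sum.mono_neutral_cong_right) (auto simp: y_def)
  have "sqnorm (V - \<sigma>) (mv \<sigma> a x) \<le> sqnorm V (mv V a y)"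
    unfolding mv unfolding sqnorm_def using assms(1) by (intro sum_mono2) auto
  also have "\<dots> \<le> sqnorm V y" using assms(3) by (simp add: contraction_on_def)
  also have "\<dots> = sqnorm \<sigma> x"
    unfolding sqnorm_def using assms(1,2)
    by (intro sum.mono_neutral_cong_right) (auto simp: y_def)
  finally show ?thesis .
qed

text \<open>Outside \<open>\<sigma>\<close> the vectors \<open>B v\<close> of all free coordinates together form, up to conjugation, the
  block of \<open>a B\<close> with rows in \<open>V - \<sigma>\<close> and columns in \<open>\<sigma>\<close>. Its squared Frobenius norm is
  estimated column by column.\<close>

lemma sum_border_corr_le:
  assumes fin: "finite V" and sub: "\<sigma> \<subseteq> V" and contr: "contraction_on V a"
    and herm: "hermitian_on V a" and hB: "hermitian_on \<sigma> B"
  shows "(\<Sum>i\<in>V-\<sigma>. sqnorm \<sigma> (border_corr \<sigma> (shifted b a) B i)) \<le> (\<Sum>m\<in>\<sigma>. sqnorm \<sigma> (\<lambda>l. B l m))"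
proof -
  have entry: "cmod (border_corr \<sigma> (shifted b a) B i m) = cmod (mv \<sigma> a (\<lambda>l. B l m) i)"
    if i: "i \<in> V - \<sigma>" and m: "m \<in> \<sigma>" for i m
  proof -
    have "border_corr \<sigma> (shifted b a) B i m = - cnj (mv \<sigma> a (\<lambda>l. B l m) i)"
      unfolding border_corr_def mv_def cnj_sum sum_negf[symmetric]
      using i m sub
      by (intro sum.cong refl)
        (auto simp: shifted_def hermitian_onD[OF herm] hermitian_onD[OF hB] subset_iff)
    then show ?thesis by simp
  qed
  have "(\<Sum>i\<in>V-\<sigma>. sqnorm \<sigma> (border_corr \<sigma> (shifted b a) B i)) =
      (\<Sum>i\<in>V-\<sigma>. \<Sum>m\<in>\<sigma>. (cmod (mv \<sigma> a (\<lambda>l. B l m) i))\<^sup>2)"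
    unfolding sqnorm_def using entry by (intro sum.cong) auto
  also have "\<dots> = (\<Sum>m\<in>\<sigma>. sqnorm (V - \<sigma>) (mv \<sigma> a (\<lambda>l. B l m)))"
    unfolding sqnorm_def by (rule sum.swap)
  also have "\<dots> \<le> (\<Sum>m\<in>\<sigma>. sqnorm \<sigma> (\<lambda>l. B l m))"
    by (intro sum_mono contraction_compression[OF fin sub contr])
  finally show ?thesis .
qed

text \<open>The coupling \<open>v\<^sup>* B v\<close> is the amount by which a new coordinate lowers its diagonal entry in the
  Schur complement.\<close>

lemma coupling_nonneg:
  assumes inv: "psd_inverse \<sigma> M' B"
  shows "0 \<le> Re (ip \<sigma> (\<lambda>l. M l i) (border_corr \<sigma> M B i))"
proof -
  obtain C where gram: "is_gram \<sigma> B C"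
    by (rule psd_inverse_gram[OF inv])
  show ?thesis unfolding border_corr_def
    by (simp add: gram_quadratic_form[OF gram] sqnorm_nonneg)
qed

text \<open>With \<open>B = C C\<^sup>*\<close> the coupling of \<open>i\<close> is the squared norm of row \<open>i\<close> of \<open>a C\<close>, so the
  total is at most the squared Frobenius norm of \<open>C\<close>, which is \<open>tr B\<close>.\<close>

lemma sum_coupling_le:
  assumes fin: "finite V" and sub: "\<sigma> \<subseteq> V" and contr: "contraction_on V a"
    and herm: "hermitian_on V a" and inv: "psd_inverse \<sigma> M' B"
  shows "(\<Sum>i\<in>V-\<sigma>. Re (ip \<sigma> (\<lambda>l. shifted b a l i) (border_corr \<sigma> (shifted b a) B i))) \<le> tr_on \<sigma> B"
proof -
  obtain C where gram: "is_gram \<sigma> B C"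
    by (rule psd_inverse_gram[OF inv])
  note C = is_gramD[OF gram]
  have entry: "Re (ip \<sigma> (\<lambda>l. shifted b a l i) (border_corr \<sigma> (shifted b a) B i)) =
      (\<Sum>r\<in>\<sigma>. (cmod (mv \<sigma> a (\<lambda>l. C l r) i))\<^sup>2)" if i: "i \<in> V - \<sigma>" for i
  proof -
    have "cmod (\<Sum>l\<in>\<sigma>. cnj (C l r) * shifted b a l i) = cmod (mv \<sigma> a (\<lambda>l. C l r) i)" for r
    proof -
      have "(\<Sum>l\<in>\<sigma>. cnj (C l r) * shifted b a l i) = - cnj (mv \<sigma> a (\<lambda>l. C l r) i)"
        unfolding mv_def cnj_sum sum_negf[symmetric]
        using i sub
        by (intro sum.cong refl) (auto simp: shifted_def hermitian_onD[OF herm] subset_iff)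
      then show ?thesis by simp
    qed
    then show ?thesis unfolding border_corr_def
      by (simp add: gram_quadratic_form[OF gram] sqnorm_def)
  qed
  have "(\<Sum>i\<in>V-\<sigma>. Re (ip \<sigma> (\<lambda>l. shifted b a l i) (border_corr \<sigma> (shifted b a) B i))) =
      (\<Sum>i\<in>V-\<sigma>. \<Sum>r\<in>\<sigma>. (cmod (mv \<sigma> a (\<lambda>l. C l r) i))\<^sup>2)"
    using entry by (intro sum.cong) auto
  also have "\<dots> = (\<Sum>r\<in>\<sigma>. sqnorm (V - \<sigma>) (mv \<sigma> a (\<lambda>l. C l r)))"
    unfolding sqnorm_def by (rule sum.swap)
  also have "\<dots> \<le> (\<Sum>r\<in>\<sigma>. sqnorm \<sigma> (\<lambda>l. C l r))"
    by (intro sum_mono contraction_compression[OF fin sub contr])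
  also have "\<dots> = (\<Sum>l\<in>\<sigma>. \<Sum>r\<in>\<sigma>. (cmod (C l r))\<^sup>2)"
    unfolding sqnorm_def by (rule sum.swap)
  also have "\<dots> = tr_on \<sigma> B"
    unfolding tr_on_def
    by (intro sum.cong refl) (simp only: C Re_sum Re_mult_cnj)
  finally show ?thesis .
qed

section \<open>The greedy choice\<close>

text \<open>If the inequality failed for every \<open>i\<close>, its sum over \<open>S\<close> would fail too; but the bounds on the
  sums of \<open>x\<close> and \<open>y\<close> give the summed inequality. Cross-multiplying the ratio
  \<open>(k + x\<^sub>i) / (b - y\<^sub>i)\<close> makes the averaging linear, and for \<open>x\<^sub>i \<ge> 0\<close> the chosen \<open>i\<close>
  automatically has \<open>b - y\<^sub>i > 0\<close>.\<close>

lemma averaging_choice: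
  fixes x y :: "'a \<Rightarrow> real"
  assumes fin: "finite S" and N: "0 < N" "N \<le> real (card S)"
    and X: "(\<Sum>i\<in>S. x i) \<le> N * X" "0 \<le> X" and Y: "(\<Sum>i\<in>S. y i) \<le> N * Y" "0 \<le> Y"
    and c: "0 < c" "c \<le> b - Y" and k: "0 < k"
  shows "\<exists>i\<in>S. c * (k + x i) \<le> (k + X) * (b - y i)"
proof (rule ccontr)
  define p where "p = real (card S)"
  assume "\<not> ?thesis"
  then have "\<And>i. i \<in> S \<Longrightarrow> (k + X) * (b - y i) < c * (k + x i)" by force
  moreover have "S \<noteq> {}" using N by auto
  ultimately have "(\<Sum>i\<in>S. (k + X) * (b - y i)) < (\<Sum>i\<in>S. c * (k + x i))"
    using fin by (intro sum_strict_mono) auto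
  then have less: "(k + X) * (p * b - (\<Sum>i\<in>S. y i)) < c * (p * k + (\<Sum>i\<in>S. x i))"
    by (simp add: sum_distrib_left[symmetric] sum.distrib sum_subtractf p_def)
  have "N * X \<le> p * X" "N * Y \<le> p * Y"
    using N X(2) Y(2) by (simp_all add: p_def mult_right_mono)
  then have "p * k + (\<Sum>i\<in>S. x i) \<le> p * (k + X)" "p * (b - Y) \<le> p * b - (\<Sum>i\<in>S. y i)"
    using X Y by (simp_all add: algebra_simps)
  moreover have "p * c \<le> p * (b - Y)" using c(2) by (simp add: p_def mult_left_mono)
  ultimately have "c * (p * k + (\<Sum>i\<in>S. x i)) \<le> c * (p * (k + X))"
    and "(k + X) * (p * c) \<le> (k + X) * (p * b - (\<Sum>i\<in>S. y i))"
    using c(1) k X(2) by (auto intro!: mult_left_mono)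
  with less show False by (simp add: mult_ac)
qed

text \<open>The value \<open>\<delta> = 1/(cN)\<close> is the one for which the trace drop \<open>\<delta> F\<close> caused by the shift equals the
  average contribution \<open>(F/N)/c\<close> of the terms \<open>\<parallel>B v\<parallel>\<^sup>2\<close>; only \<open>k/c\<close> remains of the growth.\<close>

lemma greedy_step:
  fixes a :: "'j \<Rightarrow> 'a \<Rightarrow> 'a \<Rightarrow> complex"
  assumes fin: "finite V" "finite J" "J \<noteq> {}" and sub: "\<sigma> \<subseteq> V"
    and herm: "\<And>j. j \<in> J \<Longrightarrow> hermitian_on V (a j)"
    and contr: "\<And>j. j \<in> J \<Longrightarrow> contraction_on V (a j)"
    and diag: "\<And>j i. j \<in> J \<Longrightarrow> i \<in> V \<Longrightarrow> a j i i = 0"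
    and inv: "\<And>j. j \<in> J \<Longrightarrow> psd_inverse \<sigma> (shifted b (a j)) (B j)"
    and N: "0 < N" "N \<le> real (card (V - \<sigma>))"
    and c: "0 < c" "\<delta> = 1 / (c * N)" "c \<le> b + \<delta> - (\<Sum>j\<in>J. tr_on \<sigma> (B j)) / N"
  shows "\<exists>i\<in>V-\<sigma>. \<exists>B'. (\<forall>j\<in>J. psd_inverse (insert i \<sigma>) (shifted (b + \<delta>) (a j)) (B' j)) \<and>
           (\<Sum>j\<in>J. tr_on (insert i \<sigma>) (B' j)) \<le> (\<Sum>j\<in>J. tr_on \<sigma> (B j)) + real (card J) / c"
proof -
  define b' where "b' = b + \<delta>"
  define k where "k = real (card J)"
  have \<delta>0: "0 < \<delta>" using c N by simp
  have k0: "0 < k" using fin by (simp add: k_def card_gt_0_iff)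
  have fs: "finite \<sigma>" using fin(1) sub finite_subset by blast
  have hs: "hermitian_on \<sigma> (a j)" if "j \<in> J" for j
    using hermitian_on_subset[OF herm[OF that] sub] .
  have "\<exists>D. psd_inverse \<sigma> (shifted b' (a j)) D" if j: "j \<in> J" for j
  proof -
    have "posdef_on \<sigma> (shifted b (a j))"
      by (rule psd_inverse_posdef[OF fs inv[OF j] hermitian_on_shifted[OF hs[OF j]]])
    then have "posdef_on \<sigma> (shifted b' (a j))"
      using posdef_shifted_mono[OF fs, of b b' "a j"] \<delta>0 by (simp add: b'_def)
    then show ?thesis by (rule posdef_psd_inverse[OF fs hermitian_on_shifted[OF hs[OF j]]])
  qed
  then obtain D where D: "\<And>j. j \<in> J \<Longrightarrow> psd_inverse \<sigma> (shifted b' (a j)) (D j)" by metis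
  define u where "u = (\<lambda>j. border_corr \<sigma> (shifted b' (a j)) (D j))"
  define x where "x = (\<lambda>i. \<Sum>j\<in>J. sqnorm \<sigma> (u j i))"
  define yj where "yj = (\<lambda>j i. Re (ip \<sigma> (\<lambda>l. shifted b' (a j) l i) (u j i)))"
  define y where "y = (\<lambda>i. \<Sum>j\<in>J. yj j i)"
  define F where "F = (\<Sum>j\<in>J. \<Sum>m\<in>\<sigma>. sqnorm \<sigma> (\<lambda>l. D j l m))"
  define T where "T = (\<Sum>j\<in>J. tr_on \<sigma> (B j))"
  define T' where "T' = (\<Sum>j\<in>J. tr_on \<sigma> (D j))"
  have F0: "0 \<le> F" by (auto simp: F_def sqnorm_nonneg intro!: sum_nonneg)
  have "T' + \<delta> * F = (\<Sum>j\<in>J. tr_on \<sigma> (D j) + (b' - b) * (\<Sum>m\<in>\<sigma>. sqnorm \<sigma> (\<lambda>l. D j l m)))"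
    by (simp add: T'_def F_def b'_def sum.distrib sum_distrib_left)
  also have "\<dots> \<le> T"
    unfolding T_def using \<delta>0
    by (intro sum_mono trace_drop_under_shift[OF fs hs _ inv D]) (auto simp: b'_def)
  finally have shift: "T' + \<delta> * F \<le> T" .
  have yj0: "0 \<le> yj j i" if "j \<in> J" for i j
    unfolding yj_def u_def by (rule coupling_nonneg[OF D[OF that]])
  have sx: "(\<Sum>i\<in>V-\<sigma>. x i) \<le> F"
    unfolding x_def F_def u_def
    by (subst sum.swap)
      (intro sum_mono sum_border_corr_le[OF fin(1) sub contr herm psd_inverse_hermitian[OF D]])
  have sy: "(\<Sum>i\<in>V-\<sigma>. y i) \<le> T'"
    unfolding y_def T'_def yj_def u_def
    by (subst sum.swap) (intro sum_mono sum_coupling_le[OF fin(1) sub contr herm D])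
  have T'0: "0 \<le> T'"
  proof -
    have "0 \<le> (\<Sum>i\<in>V-\<sigma>. y i)" unfolding y_def using yj0 by (intro sum_nonneg) auto
    then show ?thesis using sy by simp
  qed
  have "T' \<le> T" using shift \<delta>0 F0 mult_nonneg_nonneg[of \<delta> F] by linarith
  then have "T' / N \<le> T / N" using N(1) by (simp add: divide_right_mono)
  then have gap: "c \<le> b' - T' / N" using c(3) by (simp add: b'_def T_def)
  obtain i where i: "i \<in> V - \<sigma>" and good: "c * (k + x i) \<le> (k + F / N) * (b' - y i)"
    using averaging_choice[of "V - \<sigma>" N x "F / N" y "T' / N" c b' k]
      fin(1) N sx sy F0 T'0 c(1) gap k0 by auto
  have x0: "0 \<le> x i" by (auto simp: x_def sqnorm_nonneg intro!: sum_nonneg)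
  have kF: "0 < k + F / N" using k0 F0 N(1) by (simp add: add_pos_nonneg)
  have "0 < c * (k + x i)" using c(1) k0 x0 by simp
  then have "0 < (k + F / N) * (b' - y i)" using good by linarith
  then have by0: "0 < b' - y i" using kF zero_less_mult_pos by blast
  have schur: "schur_compl \<sigma> (shifted b' (a j)) (D j) i = b' - yj j i" if "j \<in> J" for j
    using diag[OF that, of i] i by (simp add: schur_compl_def yj_def u_def shifted_def)
  have s_ge: "b' - y i \<le> b' - yj j i" if "j \<in> J" for j
    unfolding y_def using member_le_sum[of j J "\<lambda>j. yj j i"] that yj0 fin(2) by auto
  have "\<exists>E. psd_inverse (insert i \<sigma>) (shifted b' (a j)) E \<and>
      tr_on (insert i \<sigma>) E = tr_on \<sigma> (D j) + (1 + sqnorm \<sigma> (u j i)) / (b' - yj j i)"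
    if j: "j \<in> J" for j
  proof -
    have "hermitian_on (insert i \<sigma>) (shifted b' (a j))"
      using hermitian_on_subset[OF herm[OF j], of "insert i \<sigma>"] sub i hermitian_on_shifted by blast
    then show ?thesis
      using psd_inverse_insert[OF fs _ _ D[OF j], of i] schur[OF j] s_ge[OF j] by0 i
      by (simp add: u_def)
  qed
  then obtain E where E: "\<And>j. j \<in> J \<Longrightarrow> psd_inverse (insert i \<sigma>) (shifted b' (a j)) (E j)"
    and trE: "\<And>j. j \<in> J \<Longrightarrow>
      tr_on (insert i \<sigma>) (E j) = tr_on \<sigma> (D j) + (1 + sqnorm \<sigma> (u j i)) / (b' - yj j i)"
    by metis
  \<comment> \<open>Replacing every Schur complement by the smaller common value \<open>b' - y i\<close> makes the sum over \<open>j\<close> explicit.\<close>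
  have "(\<Sum>j\<in>J. tr_on (insert i \<sigma>) (E j)) \<le> (\<Sum>j\<in>J. tr_on \<sigma> (D j) + (1 + sqnorm \<sigma> (u j i)) / (b' - y i))"
  proof (intro sum_mono)
    fix j assume j: "j \<in> J"
    have "(1 + sqnorm \<sigma> (u j i)) / (b' - yj j i) \<le> (1 + sqnorm \<sigma> (u j i)) / (b' - y i)"
      using s_ge[OF j] by0 sqnorm_nonneg[of \<sigma> "u j i"] by (intro divide_left_mono) auto
    then show "tr_on (insert i \<sigma>) (E j) \<le> tr_on \<sigma> (D j) + (1 + sqnorm \<sigma> (u j i)) / (b' - y i)"
      using trE[OF j] by simp
  qed
  also have "\<dots> = T' + (k + x i) / (b' - y i)"
    by (simp add: T'_def k_def x_def sum.distrib sum_divide_distrib[symmetric])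
  also have "\<dots> \<le> T' + (k + F / N) / c"
    using good by0 c(1) by (simp add: field_simps)
  also have "\<dots> = T' + \<delta> * F + k / c"
    using c N by (simp add: field_simps)
  also have "\<dots> \<le> T + k / c" using shift by simp
  finally show ?thesis using i E unfolding b'_def T_def k_def by blast
qed

text \<open>After \<open>t\<close> steps the barrier is at \<open>\<epsilon> - (M - t)\<delta>\<close> and \<open>T/N \<le> k t \<delta>\<close>, so the margin
  \<open>b' - T/N\<close> of the next step is at least \<open>\<epsilon> - (M - t - 1)\<delta> - k t \<delta> \<ge> \<epsilon> - k M \<delta>\<close>. The choice
  \<open>c = \<epsilon>/2\<close> optimises the requirement \<open>k M \<delta> \<le> \<epsilon> - c\<close> with \<open>\<delta> = 1/(cN)\<close>, and this is the
  size condition.\<close>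

lemma one_sided_paving:
  fixes a :: "'j \<Rightarrow> 'a \<Rightarrow> 'a \<Rightarrow> complex"
  assumes fin: "finite V" "finite J" "J \<noteq> {}"
    and herm: "\<And>j. j \<in> J \<Longrightarrow> hermitian_on V (a j)"
    and contr: "\<And>j. j \<in> J \<Longrightarrow> contraction_on V (a j)"
    and diag: "\<And>j i. j \<in> J \<Longrightarrow> i \<in> V \<Longrightarrow> a j i i = 0"
    and \<epsilon>: "0 < \<epsilon>" and M: "M < card V"
    and size: "4 * real (card J) * real M \<le> \<epsilon>\<^sup>2 * (real (card V) - real M)"
  shows "\<exists>\<sigma>\<subseteq>V. card \<sigma> = M \<and> (\<forall>j\<in>J. posdef_on \<sigma> (shifted \<epsilon> (a j)))"
proof -
  define k where "k = real (card J)"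
  define N where "N = real (card V) - real M"
  define c where "c = \<epsilon> / 2"
  define \<delta> where "\<delta> = 1 / (c * N)"
  have N0: "0 < N" using M by (simp add: N_def)
  have c0: "0 < c" using \<epsilon> by (simp add: c_def)
  have \<delta>0: "0 < \<delta>" using c0 N0 by (simp add: \<delta>_def)
  have k1: "1 \<le> k" using fin by (simp add: k_def Suc_le_eq card_gt_0_iff)
  have budget: "k * real M * \<delta> \<le> \<epsilon> / 2"
    using size \<epsilon> N0 by (simp add: \<delta>_def c_def k_def N_def field_simps power2_eq_square)
  have "t \<le> M \<Longrightarrow> \<exists>\<sigma>\<subseteq>V. card \<sigma> = t \<and> (\<exists>B.
      (\<forall>j\<in>J. psd_inverse \<sigma> (shifted (\<epsilon> - real (M - t) * \<delta>) (a j)) (B j)) \<and>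
      (\<Sum>j\<in>J. tr_on \<sigma> (B j)) \<le> real t * (k / c))" for t
  proof (induction t)
    case 0
    show ?case
      by (rule exI[of _ "{}"]) (auto simp: psd_inverse_def is_gram_def tr_on_def)
  next
    case (Suc t)
    define b where "b = \<epsilon> - real (M - t) * \<delta>"
    obtain \<sigma> B where sub: "\<sigma> \<subseteq> V" and card: "card \<sigma> = t"
      and B: "\<And>j. j \<in> J \<Longrightarrow> psd_inverse \<sigma> (shifted b (a j)) (B j)"
      and tr: "(\<Sum>j\<in>J. tr_on \<sigma> (B j)) \<le> real t * (k / c)"
      using Suc unfolding b_def by auto
    have b': "b + \<delta> = \<epsilon> - real (M - Suc t) * \<delta>"
      using Suc.prems by (simp add: b_def of_nat_diff algebra_simps)
    have fs: "finite \<sigma>" using fin(1) sub finite_subset by blast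
    have "N \<le> real (card (V - \<sigma>))"
      using sub fs card Suc.prems M by (simp add: N_def card_Diff_subset of_nat_diff)
    moreover have "c \<le> b + \<delta> - (\<Sum>j\<in>J. tr_on \<sigma> (B j)) / N"
    proof -
      have "(\<Sum>j\<in>J. tr_on \<sigma> (B j)) / N \<le> real t * (k / c) / N"
        using divide_right_mono[OF tr less_imp_le[OF N0]] .
      also have "\<dots> = (k * real t) * \<delta>" by (simp add: \<delta>_def)
      finally have 1: "(\<Sum>j\<in>J. tr_on \<sigma> (B j)) / N \<le> (k * real t) * \<delta>" .
      have "1 * real (M - Suc t) \<le> k * real (M - t)"
        using k1 by (intro mult_mono) auto
      then have "real (M - Suc t) + k * real t \<le> k * real M"
        using Suc.prems by (simp add: of_nat_diff algebra_simps)
      then have "(real (M - Suc t) + k * real t) * \<delta> \<le> k * real M * \<delta>"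
        using \<delta>0 by (intro mult_right_mono) auto
      with budget 1 show ?thesis unfolding b' by (simp add: c_def algebra_simps)
    qed
    ultimately obtain i B' where i: "i \<in> V - \<sigma>"
      and B': "\<forall>j\<in>J. psd_inverse (insert i \<sigma>) (shifted (b + \<delta>) (a j)) (B' j)"
      and tr': "(\<Sum>j\<in>J. tr_on (insert i \<sigma>) (B' j)) \<le> (\<Sum>j\<in>J. tr_on \<sigma> (B j)) + real (card J) / c"
      using greedy_step[of V J \<sigma> a b B N c \<delta>, OF fin sub herm contr diag B N0 _ c0 \<delta>_def] by blast
    have "(\<Sum>j\<in>J. tr_on (insert i \<sigma>) (B' j)) \<le> real (Suc t) * (k / c)"
      using tr tr' by (simp add: k_def algebra_simps add_divide_distrib)
    moreover have "card (insert i \<sigma>) = Suc t" using i fs card by simp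
    moreover have "insert i \<sigma> \<subseteq> V" using i sub by auto
    ultimately show ?case using B' unfolding b' by blast
  qed
  from this[of M] obtain \<sigma> B where sub: "\<sigma> \<subseteq> V" and card: "card \<sigma> = M"
    and B: "\<And>j. j \<in> J \<Longrightarrow> psd_inverse \<sigma> (shifted \<epsilon> (a j)) (B j)" by auto
  have fs: "finite \<sigma>" using fin(1) sub finite_subset by blast
  have "posdef_on \<sigma> (shifted \<epsilon> (a j))" if "j \<in> J" for j
    using psd_inverse_posdef[OF fs B[OF that]] herm[OF that] sub
    by (meson hermitian_on_shifted hermitian_on_subset)
  then show ?thesis using sub card by blast
qed

section \<open>Passage to matrices\<close>

definition entries :: "complex mat \<Rightarrow> nat \<Rightarrow> nat \<Rightarrow> complex" where
  "entries A = (\<lambda>i l. A $$ (i, l))"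

lemma hermitian_entries:
  assumes "A \<in> carrier_mat n n" "hermitian_mat A"
  shows "hermitian_on {..<n} (entries A)"
  unfolding hermitian_on_def
proof (intro ballI)
  fix l m assume "l \<in> {..<n}" "m \<in> {..<n}"
  then have "mat_adjoint A $$ (m, l) = cnj (A $$ (l, m))"
    using assms(1) by (simp add: mat_adjoint_def mat_of_rows_def)
  then show "entries A m l = cnj (entries A l m)"
    using assms(2) by (simp add: hermitian_mat_def entries_def)
qed

lemma mult_mat_vec_entries:
  assumes "A \<in> carrier_mat n n" "v \<in> carrier_vec n" "i < n"
  shows "(A *\<^sub>v v) $ i = mv {..<n} (entries A) (\<lambda>l. v $ l) i"
  using assms by (simp add: scalar_prod_def mv_def entries_def atLeast0LessThan)

lemma l2_norm_sqnorm: "v \<in> carrier_vec n \<Longrightarrow> (l2_norm v)\<^sup>2 = sqnorm {..<n} (\<lambda>l. v $ l)"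
  using sqnorm_nonneg[of "{..<n}" "\<lambda>l. v $ l"] by (simp add: l2_norm_def sqnorm_def)

lemma l2_norm_nonneg: "0 \<le> l2_norm v"
  by (simp add: l2_norm_def sum_nonneg)

lemma l2_norm_image_sqnorm:
  assumes "A \<in> carrier_mat n n" "v \<in> carrier_vec n"
  shows "(l2_norm (A *\<^sub>v v))\<^sup>2 = sqnorm {..<n} (mv {..<n} (entries A) (\<lambda>l. v $ l))"
proof -
  have "A *\<^sub>v v \<in> carrier_vec n" using assms by simp
  then have "(l2_norm (A *\<^sub>v v))\<^sup>2 = sqnorm {..<n} (\<lambda>l. (A *\<^sub>v v) $ l)" by (rule l2_norm_sqnorm)
  also have "\<dots> = sqnorm {..<n} (mv {..<n} (entries A) (\<lambda>l. v $ l))"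
    by (rule sqnorm_cong) (use mult_mat_vec_entries[OF assms] in auto)
  finally show ?thesis .
qed

text \<open>A real supremum bounds its members only if the set is bounded above; the row sums of absolute
  values supply a crude bound.\<close>

lemma op_norm_bdd:
  assumes "A \<in> carrier_mat n n"
  shows "bdd_above ((\<lambda>v. l2_norm (A *\<^sub>v v)) ` {v \<in> carrier_vec (dim_col A). l2_norm v = 1})"
proof (rule bdd_aboveI2)
  fix v assume "v \<in> {v \<in> carrier_vec (dim_col A). l2_norm v = 1}"
  then have v: "v \<in> carrier_vec n" and v1: "l2_norm v = 1" using assms by auto
  have le1: "cmod (v $ l) \<le> 1" if "l < n" for l
  proof -
    have "(cmod (v $ l))\<^sup>2 \<le> sqnorm {..<n} (\<lambda>l. v $ l)"
      unfolding sqnorm_def using that by (intro member_le_sum) auto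
    then show ?thesis using l2_norm_sqnorm[OF v] v1 by (simp add: power2_le_imp_le power_le_one_iff abs_square_le_1)
  qed
  have "(l2_norm (A *\<^sub>v v))\<^sup>2 \<le> (\<Sum>i<n. (\<Sum>l<n. cmod (entries A i l))\<^sup>2)"
    unfolding l2_norm_image_sqnorm[OF assms v] sqnorm_def
  proof (intro sum_mono power_mono)
    fix i
    have "cmod (mv {..<n} (entries A) (\<lambda>l. v $ l) i) \<le> (\<Sum>l<n. cmod (entries A i l * v $ l))"
      unfolding mv_def by (rule norm_sum)
    also have "\<dots> \<le> (\<Sum>l<n. cmod (entries A i l))"
      using le1 by (intro sum_mono) (auto simp: norm_mult mult_left_le)
    finally show "cmod (mv {..<n} (entries A) (\<lambda>l. v $ l) i) \<le> (\<Sum>l<n. cmod (entries A i l))" .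
  qed auto
  then show "l2_norm (A *\<^sub>v v) \<le> sqrt (\<Sum>i<n. (\<Sum>l<n. cmod (entries A i l))\<^sup>2)"
    by (rule real_le_rsqrt)
qed

lemma contraction_entries:
  assumes A: "A \<in> carrier_mat n n" and contr: "contraction_mat A"
  shows "contraction_on {..<n} (entries A)"
  unfolding contraction_on_def
proof
  fix x :: "nat \<Rightarrow> complex"
  define r where "r = sqnorm {..<n} x"
  show "sqnorm {..<n} (mv {..<n} (entries A) x) \<le> sqnorm {..<n} x"
  proof (cases "r = 0")
    case True
    then have "\<And>l. l < n \<Longrightarrow> x l = 0"
      by (auto simp: r_def sqnorm_def sum_nonneg_eq_0_iff)
    then have "mv {..<n} (entries A) x = (\<lambda>_. 0)" by (auto simp: mv_def)
    then show ?thesis using True by (simp add: r_def sqnorm_def)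
  next
    case False
    then have r: "0 < r" using sqnorm_nonneg[of "{..<n}" x] by (simp add: r_def)
    define v where "v = vec n (\<lambda>l. x l / of_real (sqrt r))"
    have v: "v \<in> carrier_vec n" by (simp add: v_def)
    have "sqnorm {..<n} (\<lambda>l. v $ l) = 1"
      using r by (simp add: v_def sqnorm_def norm_divide power_divide sum_divide_distrib[symmetric])
        (simp add: r_def sqnorm_def)
    then have "l2_norm v = 1"
      using l2_norm_sqnorm[OF v] l2_norm_nonneg[of v] by (simp add: power2_eq_1_iff)
    then have "l2_norm (A *\<^sub>v v) \<le> op_norm A"
      unfolding op_norm_def using v A by (intro cSUP_upper op_norm_bdd[OF A]) auto
    then have "(l2_norm (A *\<^sub>v v))\<^sup>2 \<le> 1"
      using contr l2_norm_nonneg[of "A *\<^sub>v v"] by (simp add: contraction_mat_def power_le_one)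
    moreover have "(l2_norm (A *\<^sub>v v))\<^sup>2 = sqnorm {..<n} (mv {..<n} (entries A) x) / r"
    proof -
      have "mv {..<n} (entries A) (\<lambda>l. v $ l) = (\<lambda>i. mv {..<n} (entries A) x i / of_real (sqrt r))"
        unfolding mv_def by (auto simp: v_def sum_divide_distrib)
      then show ?thesis
        using r by (simp add: l2_norm_image_sqnorm[OF A v] sqnorm_def norm_divide power_divide
            sum_divide_distrib)
    qed
    ultimately show ?thesis using r by (simp add: r_def)
  qed
qed

lemma diag_proj_compress:
  assumes "A \<in> carrier_mat n n"
  shows "diag_proj n \<sigma> * A * diag_proj n \<sigma> =
    mat n n (\<lambda>(i, l). if i \<in> \<sigma> \<and> l \<in> \<sigma> then A $$ (i, l) else 0)"
  unfolding diag_proj_def mat_diag_mult_left[OF assms]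
  by (subst mat_diag_mult_right[of _ n]) (auto intro!: eq_matI)

text \<open>An eigenvector for an eigenvalue at least \<open>\<epsilon>\<close>, hence nonzero, vanishes off \<open>\<sigma>\<close>, and on
  \<open>\<sigma>\<close> it contradicts positive definiteness. For the maximum to be one of the eigenvalues, the set of
  real eigenvalues has to be finite and nonempty; it is nonempty because a Hermitian matrix has only real
  eigenvalues.\<close>

lemma lambda_max_compression_less:
  assumes A: "A \<in> carrier_mat n n" and herm: "hermitian_mat A" and n: "0 < n"
    and sub: "\<sigma> \<subseteq> {..<n}" and \<epsilon>: "0 < \<epsilon>" and pd: "posdef_on \<sigma> (shifted \<epsilon> (entries A))"
  shows "lambda_max (diag_proj n \<sigma> * A * diag_proj n \<sigma>) < \<epsilon>"
proof -
  define M where "M = diag_proj n \<sigma> * A * diag_proj n \<sigma>"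
  have Meq: "M = mat n n (\<lambda>(i, l). if i \<in> \<sigma> \<and> l \<in> \<sigma> then A $$ (i, l) else 0)"
    unfolding M_def by (rule diag_proj_compress[OF A])
  have Mc: "M \<in> carrier_mat n n" by (simp add: Meq)
  have fs: "finite \<sigma>" using sub finite_subset by blast
  have hA: "hermitian_on {..<n} (entries A)" by (rule hermitian_entries[OF A herm])
  have hM: "hermitian_on {..<n} (entries M)"
    unfolding hermitian_on_def[of _ "entries M"]
    using hermitian_onD[OF hA] by (auto simp: entries_def Meq)
  have eig: "\<exists>x. (\<exists>l<n. x l \<noteq> 0) \<and> (\<forall>i<n. mv {..<n} (entries M) x i = \<mu> * x i)"
    if ev: "eigenvalue M \<mu>" for \<mu>
  proof -
    obtain v where v: "v \<in> carrier_vec n" "v \<noteq> 0\<^sub>v n" "M *\<^sub>v v = \<mu> \<cdot>\<^sub>v v"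
      using ev carrier_matD(1)[OF Mc] by (auto simp: eigenvalue_def eigenvector_def)
    have "\<exists>l<n. v $ l \<noteq> 0" using v(1,2) by (metis carrier_vecD eq_vecI index_zero_vec)
    moreover have "mv {..<n} (entries M) (\<lambda>l. v $ l) i = \<mu> * v $ i" if "i < n" for i
      using mult_mat_vec_entries[OF Mc v(1) that] v(1,3) that by simp
    ultimately show ?thesis by blast
  qed
  have real: "\<exists>r. \<mu> = of_real r" if ev: "eigenvalue M \<mu>" for \<mu>
  proof -
    obtain x where x: "\<exists>l<n. x l \<noteq> 0" "\<And>i. i < n \<Longrightarrow> mv {..<n} (entries M) x i = \<mu> * x i"
      using eig[OF ev] by auto
    have "ip {..<n} x (mv {..<n} (entries M) x) = \<mu> * ip {..<n} x x"
      using x(2) by (simp add: ip_def sum_distrib_left mult_ac)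
    moreover have "ip {..<n} (mv {..<n} (entries M) x) x = cnj \<mu> * ip {..<n} x x"
      using x(2) by (simp add: ip_def sum_distrib_left mult_ac)
    moreover have "sqnorm {..<n} x \<noteq> 0"
      using x(1) by (auto simp: sqnorm_def sum_nonneg_eq_0_iff)
    ultimately have "cnj \<mu> = \<mu>"
      using ip_mv_hermitian[OF hM, of x x] by (simp add: ip_self)
    then show ?thesis by (metis Reals_cnj_iff Reals_cases)
  qed
  have small: "r < \<epsilon>" if ev: "eigenvalue M (of_real r)" for r
  proof (rule ccontr)
    assume "\<not> r < \<epsilon>"
    then have r: "\<epsilon> \<le> r" by simp
    obtain x where x: "\<exists>l<n. x l \<noteq> 0" "\<And>i. i < n \<Longrightarrow> mv {..<n} (entries M) x i = of_real r * x i"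
      using eig[OF ev] by auto
    have out: "x i = 0" if "i < n" "i \<notin> \<sigma>" for i
    proof -
      have "mv {..<n} (entries M) x i = 0"
        unfolding mv_def using that by (intro sum.neutral) (auto simp: entries_def Meq)
      then show ?thesis using x(2)[OF that(1)] r \<epsilon> by simp
    qed
    have in_eq: "mv \<sigma> (entries A) x i = of_real r * x i" if "i \<in> \<sigma>" for i
    proof -
      have "mv \<sigma> (entries A) x i = mv {..<n} (entries M) x i"
        unfolding mv_def using that sub
        by (intro sum.mono_neutral_cong_left) (auto simp: entries_def Meq subset_iff)
      then show ?thesis using x(2)[of i] that sub by auto
    qed
    have "ip \<sigma> x (mv \<sigma> (entries A) x) = of_real r * ip \<sigma> x x"
      using in_eq by (simp add: ip_def sum_distrib_left mult_ac)
    then have "Re (ip \<sigma> x (mv \<sigma> (entries A) x)) = r * sqnorm \<sigma> x" by (simp add: ip_self)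
    moreover have "\<exists>l\<in>\<sigma>. x l \<noteq> 0" using x(1) out by auto
    ultimately have "r * sqnorm \<sigma> x < \<epsilon> * sqnorm \<sigma> x"
      using pd posdef_shifted_iff[OF fs] by metis
    then show False using r mult_right_mono[OF r sqnorm_nonneg[of \<sigma> x]] by simp
  qed
  define S where "S = {r :: real. eigenvalue M (of_real r)}"
  have "finite (complex_of_real ` S)"
    using card_finite_spectrum(1)[OF Mc] by (rule finite_subset[rotated]) (auto simp: S_def spectrum_def)
  then have "finite S" by (rule finite_imageD) (simp add: inj_on_def)
  moreover have "S \<noteq> {}"
    using spectrum_non_empty[OF Mc n] real by (auto simp: S_def spectrum_def)
  ultimately have "Max S \<in> S" by (rule Max_in)
  then show ?thesis using small by (auto simp: S_def lambda_max_def M_def)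
qed

theorem theorem3:
  fixes n k :: nat
    and A :: "nat \<Rightarrow> complex mat"
    and \<epsilon> :: real
  assumes "n \<ge> 1" and "k \<ge> 1"
    and "\<And>j. j \<in> {1..k} \<Longrightarrow> A j \<in> carrier_mat n n"
    and "\<And>j. j \<in> {1..k} \<Longrightarrow> hermitian_mat (A j)"
    and "\<And>j. j \<in> {1..k} \<Longrightarrow> zero_diagonal (A j)"
    and "\<And>j. j \<in> {1..k} \<Longrightarrow> contraction_mat (A j)"
    and "0 < \<epsilon>" and "\<epsilon> < 1"
  shows "\<exists>\<sigma> \<subseteq> {..<n}.
           int (card \<sigma>) = \<lfloor>real n * \<epsilon>\<^sup>2 / (6 * real k)\<rfloor> \<and>
           (\<forall>j \<in> {1..k}. lambda_max (diag_proj n \<sigma> * A j * diag_proj n \<sigma>) < \<epsilon>)"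
proof -
  define M where "M = nat \<lfloor>real n * \<epsilon>\<^sup>2 / (6 * real k)\<rfloor>"
  have M: "int M = \<lfloor>real n * \<epsilon>\<^sup>2 / (6 * real k)\<rfloor>" by (simp add: M_def)
  then have "real M \<le> real n * \<epsilon>\<^sup>2 / (6 * real k)" by linarith
  then have kM: "6 * (real k * real M) \<le> \<epsilon>\<^sup>2 * real n"
    using assms(2) by (simp add: field_simps)
  have e1: "\<epsilon>\<^sup>2 \<le> 1" using assms(7,8) by (simp add: power_le_one)
  have "1 * real M \<le> real k * real M" using assms(2) by (intro mult_right_mono) auto
  moreover have "\<epsilon>\<^sup>2 * real n \<le> 1 * real n" using e1 by (intro mult_right_mono) auto
  moreover have "0 < real n" using assms(1) by simp
  ultimately have "real M < real n" using kM by linarith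
  then have Mn: "M < card {..<n}" by simp
  have "\<epsilon>\<^sup>2 * real M \<le> 1 * real M" using e1 by (intro mult_right_mono) auto
  then have size: "4 * real (card {1..k}) * real M \<le> \<epsilon>\<^sup>2 * (real (card {..<n}) - real M)"
    using kM \<open>1 * real M \<le> real k * real M\<close> by (simp add: algebra_simps)
  have diag: "entries (A j) i i = 0" if "j \<in> {1..k}" "i \<in> {..<n}" for j i
    using assms(3,5)[OF that(1)] that(2) by (auto simp: entries_def zero_diagonal_def)
  obtain \<sigma> where \<sigma>: "\<sigma> \<subseteq> {..<n}" "card \<sigma> = M"
    "\<And>j. j \<in> {1..k} \<Longrightarrow> posdef_on \<sigma> (shifted \<epsilon> (entries (A j)))"
    using one_sided_paving[of "{..<n}" "{1..k}" "\<lambda>j. entries (A j)" \<epsilon> M,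
        OF _ _ _ hermitian_entries[OF assms(3,4)] contraction_entries[OF assms(3,6)] diag assms(7) Mn size]
      assms(2) by auto
  have "lambda_max (diag_proj n \<sigma> * A j * diag_proj n \<sigma>) < \<epsilon>" if "j \<in> {1..k}" for j
    using lambda_max_compression_less[OF assms(3,4)[OF that] _ \<sigma>(1) assms(7) \<sigma>(3)[OF that]] assms(1)
    by simp
  then show ?thesis using \<sigma>(1,2) M by auto
qed

end
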